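(* A generic compact metric space is perfect: the set of $X\in\mathfrak{M}$ having no isolated point is a residual subset of the Gromov-Hausdorff space $(\mathfrak{M},d_{GH})$.
   Context: $\mathfrak{M}$ denotes the Gromov-Hausdorff space: the set of all nonempty compact metric spaces up to isometry, endowed with the Gromov-Hausdorff distance $d_{GH}(X,Y)=\inf d_H^Z(f(X),g(Y))$, where the infimum is over all metric spaces $Z$ and all isometric injections $f:X\to Z$, $g:Y\to Z$, and $d_H^Z$ is the Hausdorff distance between subsets of $Z$. The metric space $\mathfrak{M}$ is complete, hence a Baire space. A subset is rare if its closure has empty interior, meager if it is a countable union of rare sets, and residual if its complement is meager. "A generic compact metric space has property $P$" means that the set of $X\in\mathfrak{M}$ having $P$ is residual in $\mathfrak{M}$. *)

theory Defs
  imports "HOL-Analysis.Analysis"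
begin

section \<open>Isometries, compactness, Hausdorff and Gromov--Hausdorff distance\<close>

definition isometric_embedding :: "'a metric \<Rightarrow> 'b metric \<Rightarrow> ('a \<Rightarrow> 'b) \<Rightarrow> bool" where
  "isometric_embedding X Z f \<longleftrightarrow>
     f \<in> mspace X \<rightarrow> mspace Z \<and>
     (\<forall>x\<in>mspace X. \<forall>x'\<in>mspace X. mdist Z (f x) (f x') = mdist X x x')"

definition isometric :: "'a metric \<Rightarrow> 'b metric \<Rightarrow> bool" where
  "isometric X Y \<longleftrightarrow> (\<exists>f. isometric_embedding X Y f \<and> f ` mspace X = mspace Y)"

definition nonempty_compact :: "'a metric \<Rightarrow> bool" where
  "nonempty_compact X \<longleftrightarrow> mspace X \<noteq> {} \<and> compact_space (mtopology_of X)"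

definition hausdorff_distance :: "'a metric \<Rightarrow> 'a set \<Rightarrow> 'a set \<Rightarrow> real" where
  "hausdorff_distance Z A B =
     max (SUP a\<in>A. INF b\<in>B. mdist Z a b) (SUP b\<in>B. INF a\<in>A. mdist Z a b)"

text \<open>
  HOL does not quantify over types inside a term, so the ambient spaces \<open>Z\<close> are taken to have
  their points in \<^typ>\<open>real\<close>. This is no restriction: \<open>gh_distance_le_hausdorff_distance\<close> below shows
  that ambient spaces over any other type give the same infimum.
\<close>

definition gh_distance :: "real metric \<Rightarrow> real metric \<Rightarrow> real" where
  "gh_distance X Y =
     Inf {hausdorff_distance Z (f ` mspace X) (g ` mspace Y) | (Z :: real metric) f g.
            isometric_embedding X Z f \<and> isometric_embedding Y Z g}"

lemma isometric_embedding_D: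
  assumes "isometric_embedding X Z f"
  shows "x \<in> mspace X \<Longrightarrow> f x \<in> mspace Z"
    and "x \<in> mspace X \<Longrightarrow> x' \<in> mspace X \<Longrightarrow> mdist Z (f x) (f x') = mdist X x x'"
  using assms by (auto simp: isometric_embedding_def)

lemma isometric_embedding_compose:
  assumes "isometric_embedding X Y f" "isometric_embedding Y Z g"
  shows "isometric_embedding X Z (g \<circ> f)"
  using assms unfolding isometric_embedding_def by (auto simp: Pi_iff)

lemma isometric_refl: "isometric X X"
  unfolding isometric_def isometric_embedding_def by (rule exI[of _ id]) auto

lemma isometric_trans:
  assumes "isometric X Y" "isometric Y Z" shows "isometric X Z"
proof -
  obtain f g where f: "isometric_embedding X Y f" "f ` mspace X = mspace Y"
    and g: "isometric_embedding Y Z g" "g ` mspace Y = mspace Z"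
    using assms by (auto simp: isometric_def)
  then have "isometric_embedding X Z (g \<circ> f)" "(g \<circ> f) ` mspace X = mspace Z"
    by (simp_all only: isometric_embedding_compose image_comp[symmetric])
  then show ?thesis unfolding isometric_def by blast
qed

lemma isometric_embedding_inj_on: "isometric_embedding X Z f \<Longrightarrow> inj_on f (mspace X)"
  by (rule inj_onI) (metis isometric_embedding_D(2) mdist_zero)

lemma isometric_sym: assumes "isometric X Y" shows "isometric Y X"
proof -
  obtain f where f: "isometric_embedding X Y f" and im: "f ` mspace X = mspace Y"
    using assms by (auto simp: isometric_def)
  note inj = isometric_embedding_inj_on[OF f]
  let ?g = "inv_into (mspace X) f"
  have "?g ` mspace Y = mspace X"
    using inv_into_image_cancel[OF inj subset_refl] im by simp
  moreover have "isometric_embedding Y X ?g"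
    unfolding isometric_embedding_def
  proof (intro conjI ballI Pi_I)
    have g: "?g y \<in> mspace X" "f (?g y) = y" if "y \<in> mspace Y" for y
      using that im inv_into_into[of y f "mspace X"] f_inv_into_f[of y f "mspace X"] by auto
    show "?g y \<in> mspace X" if "y \<in> mspace Y" for y by (rule g(1)[OF that])
    show "mdist X (?g y) (?g y') = mdist Y y y'" if "y \<in> mspace Y" "y' \<in> mspace Y" for y y'
      using isometric_embedding_D(2)[OF f g(1)[OF that(1)] g(1)[OF that(2)]] g(2) that by simp
  qed
  ultimately show ?thesis by (auto simp: isometric_def)
qed

lemma isometric_nonempty_compact:
  assumes "isometric X Y" "nonempty_compact X" shows "nonempty_compact Y"
proof -
  obtain f where f: "isometric_embedding X Y f" and im: "f ` mspace X = mspace Y"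
    using assms by (auto simp: isometric_def)
  interpret Metric_space12 "mspace X" "mdist X" "mspace Y" "mdist Y"
    by (rule Metric_space12_mspace_mdist)
  have "homeomorphic_map (mtopology_of X) (mtopology_of Y) f"
    unfolding mtopology_of_def using isometry_imp_homeomorphic_map[OF im] f
    by (auto simp: isometric_embedding_def)
  then show ?thesis
    using assms(2) im homeomorphic_compact_space[OF homeomorphic_map_imp_homeomorphic_space]
    unfolding nonempty_compact_def by blast
qed

lemma nonempty_compact_bounded:
  assumes "nonempty_compact X"
  obtains K where "K > 0" "\<And>x x'. x \<in> mspace X \<Longrightarrow> x' \<in> mspace X \<Longrightarrow> mdist X x x' \<le> K"
proof -
  interpret M: Metric_space "mspace X" "mdist X" by simp
  have "M.mbounded (mspace X)"
    using assms M.compactin_imp_mbounded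
    by (simp add: nonempty_compact_def compact_space_def mtopology_of_def)
  then obtain B where "\<forall>x\<in>mspace X. \<forall>y\<in>mspace X. mdist X x y \<le> B"
    by (auto simp: M.mbounded_alt)
  then have "\<And>x x'. x \<in> mspace X \<Longrightarrow> x' \<in> mspace X \<Longrightarrow> mdist X x x' \<le> max 1 B"
    by (simp add: le_max_iff_disj)
  then show ?thesis using that[of "max 1 B"] by simp
qed

lemma hausdorff_distance_le:
  assumes "A \<noteq> {}" "B \<noteq> {}"
    and "\<And>a. a \<in> A \<Longrightarrow> \<exists>b\<in>B. mdist Z a b \<le> r"
    and "\<And>b. b \<in> B \<Longrightarrow> \<exists>a\<in>A. mdist Z a b \<le> r"
  shows "hausdorff_distance Z A B \<le> r"
proof -
  have "(INF b\<in>B. mdist Z a b) \<le> r" if "a \<in> A" for a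
    using assms(3)[OF that] by (auto intro!: cINF_lower2 bdd_belowI2[of _ 0])
  moreover have "(INF a\<in>A. mdist Z a b) \<le> r" if "b \<in> B" for b
    using assms(4)[OF that] by (auto intro!: cINF_lower2 bdd_belowI2[of _ 0])
  ultimately show ?thesis
    unfolding hausdorff_distance_def using assms(1,2) by (auto intro!: cSUP_least)
qed

lemma hausdorff_distance_less_D:
  assumes ne: "A \<noteq> {}" "B \<noteq> {}" and bd: "\<And>a b. a \<in> A \<Longrightarrow> b \<in> B \<Longrightarrow> mdist Z a b \<le> K"
    and less: "hausdorff_distance Z A B < r"
  shows "a \<in> A \<Longrightarrow> \<exists>b\<in>B. mdist Z a b < r"
    and "b \<in> B \<Longrightarrow> \<exists>a\<in>A. mdist Z a b < r"
    and "0 \<le> hausdorff_distance Z A B"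
proof -
  have bb: "bdd_below ((\<lambda>b. mdist Z a b) ` B)" "bdd_below ((\<lambda>a. mdist Z a b) ` A)" for a b
    by (auto intro: bdd_belowI2[of _ 0])
  obtain a0 b0 where a0: "a0 \<in> A" and b0: "b0 \<in> B" using ne by auto
  have 1: "bdd_above ((\<lambda>a. INF b\<in>B. mdist Z a b) ` A)"
    by (rule bdd_aboveI2[of _ _ K]) (rule cINF_lower2[OF bb(1) b0 bd[OF _ b0]])
  have 2: "bdd_above ((\<lambda>b. INF a\<in>A. mdist Z a b) ` B)"
    by (rule bdd_aboveI2[of _ _ K]) (rule cINF_lower2[OF bb(2) a0 bd[OF a0]])
  have u1: "(INF b\<in>B. mdist Z a b) \<le> hausdorff_distance Z A B" if "a \<in> A" for a
    using cSUP_upper[OF that 1] by (simp add: hausdorff_distance_def)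
  have u2: "(INF a\<in>A. mdist Z a b) \<le> hausdorff_distance Z A B" if "b \<in> B" for b
    using cSUP_upper[OF that 2] by (simp add: hausdorff_distance_def)
  show "\<exists>b\<in>B. mdist Z a b < r" if "a \<in> A"
    using le_less_trans[OF u1[OF that] less] cINF_less_iff[OF ne(2) bb(1)] by blast
  show "\<exists>a\<in>A. mdist Z a b < r" if "b \<in> B"
    using le_less_trans[OF u2[OF that] less] cINF_less_iff[OF ne(1) bb(2)] by blast
  have "0 \<le> (INF b\<in>B. mdist Z a0 b)" using ne by (auto intro!: cINF_greatest)
  then show "0 \<le> hausdorff_distance Z A B" using u1[OF a0] by linarith
qed


section \<open>Couplings\<close>

text \<open>
  A coupling records the distances between points of \<open>X\<close> and points of \<open>Y\<close> inside a common
  ambient space in which each of the two is contained in the open \<open>r\<close>-neighbourhood of the other.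
  Points of \<open>X\<close> and \<open>Y\<close> at distance \<open>0\<close> are allowed.
\<close>

definition coupling :: "'a metric \<Rightarrow> 'b metric \<Rightarrow> real \<Rightarrow> ('a \<Rightarrow> 'b \<Rightarrow> real) \<Rightarrow> bool" where
  "coupling X Y r \<delta> \<longleftrightarrow>
     (\<forall>x\<in>mspace X. \<forall>y\<in>mspace Y. 0 \<le> \<delta> x y) \<and>
     (\<forall>x\<in>mspace X. \<forall>x'\<in>mspace X. \<forall>y\<in>mspace Y.
        \<delta> x y \<le> mdist X x x' + \<delta> x' y \<and> mdist X x x' \<le> \<delta> x y + \<delta> x' y) \<and>
     (\<forall>x\<in>mspace X. \<forall>y\<in>mspace Y. \<forall>y'\<in>mspace Y.
        \<delta> x y \<le> \<delta> x y' + mdist Y y y' \<and> mdist Y y y' \<le> \<delta> x y + \<delta> x y') \<and>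
     (\<forall>x\<in>mspace X. \<exists>y\<in>mspace Y. \<delta> x y < r) \<and>
     (\<forall>y\<in>mspace Y. \<exists>x\<in>mspace X. \<delta> x y < r)"

lemma coupling_D:
  assumes "coupling X Y r \<delta>"
  shows "x \<in> mspace X \<Longrightarrow> y \<in> mspace Y \<Longrightarrow> 0 \<le> \<delta> x y"
    and "x \<in> mspace X \<Longrightarrow> x' \<in> mspace X \<Longrightarrow> y \<in> mspace Y \<Longrightarrow> \<delta> x y \<le> mdist X x x' + \<delta> x' y"
    and "x \<in> mspace X \<Longrightarrow> x' \<in> mspace X \<Longrightarrow> y \<in> mspace Y \<Longrightarrow> mdist X x x' \<le> \<delta> x y + \<delta> x' y"
    and "x \<in> mspace X \<Longrightarrow> y \<in> mspace Y \<Longrightarrow> y' \<in> mspace Y \<Longrightarrow> \<delta> x y \<le> \<delta> x y' + mdist Y y y'"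
    and "x \<in> mspace X \<Longrightarrow> y \<in> mspace Y \<Longrightarrow> y' \<in> mspace Y \<Longrightarrow> mdist Y y y' \<le> \<delta> x y + \<delta> x y'"
    and "x \<in> mspace X \<Longrightarrow> \<exists>y\<in>mspace Y. \<delta> x y < r"
    and "y \<in> mspace Y \<Longrightarrow> \<exists>x\<in>mspace X. \<delta> x y < r"
  using assms unfolding coupling_def by blast+

lemma coupling_sym: "coupling X Y r \<delta> \<Longrightarrow> coupling Y X r (\<lambda>y x. \<delta> x y)"
  unfolding coupling_def by (auto simp: add.commute mdist_commute)

lemma coupling_of_ambient:
  assumes X: "nonempty_compact X" and Y: "nonempty_compact Y"
    and f: "isometric_embedding X Z f" and g: "isometric_embedding Y Z g"
  shows "0 \<le> hausdorff_distance Z (f ` mspace X) (g ` mspace Y)"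
    and "hausdorff_distance Z (f ` mspace X) (g ` mspace Y) < r \<Longrightarrow>
           coupling X Y r (\<lambda>x y. mdist Z (f x) (g y))"
proof -
  have ne: "mspace X \<noteq> {}" "mspace Y \<noteq> {}" using X Y by (auto simp: nonempty_compact_def)
  then obtain x0 y0 where x0: "x0 \<in> mspace X" and y0: "y0 \<in> mspace Y" by auto
  obtain K where K: "\<And>x x'. x \<in> mspace X \<Longrightarrow> x' \<in> mspace X \<Longrightarrow> mdist X x x' \<le> K"
    using nonempty_compact_bounded[OF X] by metis
  obtain L where L: "\<And>x x'. x \<in> mspace Y \<Longrightarrow> x' \<in> mspace Y \<Longrightarrow> mdist Y x x' \<le> L"
    using nonempty_compact_bounded[OF Y] by metis
  note fD = isometric_embedding_D[OF f] and gD = isometric_embedding_D[OF g]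
  have "mdist Z (f x) (g y) \<le> K + mdist Z (f x0) (g y0) + L" if "x \<in> mspace X" "y \<in> mspace Y" for x y
  proof -
    have "mdist Z (f x) (g y) \<le> mdist Z (f x) (f x0) + mdist Z (f x0) (g y)"
      using that x0 fD(1) gD(1) by (intro mdist_triangle) auto
    moreover have "mdist Z (f x0) (g y) \<le> mdist Z (f x0) (g y0) + mdist Z (g y0) (g y)"
      using that x0 y0 fD(1) gD(1) by (intro mdist_triangle) auto
    ultimately show ?thesis using K[OF that(1) x0] L[OF y0 that(2)] fD(2)[OF that(1) x0] gD(2)[OF y0 that(2)]
      by linarith
  qed
  then have bd: "mdist Z a b \<le> K + mdist Z (f x0) (g y0) + L"
    if "a \<in> f ` mspace X" "b \<in> g ` mspace Y" for a b using that by auto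
  have ne': "f ` mspace X \<noteq> {}" "g ` mspace Y \<noteq> {}" using ne by auto
  note H = hausdorff_distance_less_D[OF ne' bd]
  show "0 \<le> hausdorff_distance Z (f ` mspace X) (g ` mspace Y)"
    using H(3)[OF _ _ less_add_one] by simp
  show "coupling X Y r (\<lambda>x y. mdist Z (f x) (g y))"
    if less: "hausdorff_distance Z (f ` mspace X) (g ` mspace Y) < r"
    unfolding coupling_def
  proof (intro conjI ballI)
    fix x assume x: "x \<in> mspace X"
    show "\<exists>y\<in>mspace Y. mdist Z (f x) (g y) < r" using H(1)[OF _ _ less] x by auto
  next
    fix y assume y: "y \<in> mspace Y"
    show "\<exists>x\<in>mspace X. mdist Z (f x) (g y) < r" using H(2)[OF _ _ less] y by auto
  next
    fix x x' y assume a: "x \<in> mspace X" "x' \<in> mspace X" "y \<in> mspace Y"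
    show "mdist Z (f x) (g y) \<le> mdist X x x' + mdist Z (f x') (g y)"
      "mdist X x x' \<le> mdist Z (f x) (g y) + mdist Z (f x') (g y)"
      using a fD gD by (metis mdist_triangle, metis mdist_triangle mdist_commute)
  next
    fix x y y' assume a: "x \<in> mspace X" "y \<in> mspace Y" "y' \<in> mspace Y"
    show "mdist Z (f x) (g y) \<le> mdist Z (f x) (g y') + mdist Y y y'"
      "mdist Y y y' \<le> mdist Z (f x) (g y) + mdist Z (f x) (g y')"
      using a fD gD by (metis mdist_triangle mdist_commute, metis mdist_triangle mdist_commute)
  qed simp
qed

lemma isometric_image_metric:
  assumes "inj_on h (mspace Z)"
  shows "\<exists>Z'. mspace Z' = h ` mspace Z \<and> isometric_embedding Z Z' h"
proof -
  let ?k = "inv_into (mspace Z) h"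
  have M: "Metric_space (h ` mspace Z) (\<lambda>u v. mdist Z (?k u) (?k v))"
    using assms by unfold_locales (auto simp: mdist_commute mdist_triangle inj_on_eq_iff)
  then show ?thesis
    using assms
    by (intro exI[of _ "metric (h ` mspace Z, \<lambda>u v. mdist Z (?k u) (?k v))"])
       (auto simp: Metric_space.mspace_metric Metric_space.mdist_metric isometric_embedding_def)
qed

lemma inj_real_sum: "\<exists>h :: real + real \<Rightarrow> real. inj h"
proof
  show "inj (\<lambda>s::real + real. case s of Inl x \<Rightarrow> exp x | Inr x \<Rightarrow> - exp x)"
  proof (rule injI)
    fix s t :: "real + real"
    have "exp a \<noteq> - exp b" "- exp a \<noteq> exp b" for a b :: real
      using exp_gt_zero[of a] exp_gt_zero[of b] by linarith+
    then show "(case s of Inl x \<Rightarrow> exp x | Inr x \<Rightarrow> - exp x) = (case t of Inl x \<Rightarrow> exp x | Inr x \<Rightarrow> - exp x)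
      \<Longrightarrow> s = t" by (auto split: sum.splits)
  qed
qed

lemma ambient_of_coupling:
  fixes X Y :: "real metric"
  assumes ne: "mspace X \<noteq> {}" "mspace Y \<noteq> {}" and c: "coupling X Y r \<delta>" and e: "e > 0"
  shows "\<exists>(Z :: real metric) f g. isometric_embedding X Z f \<and> isometric_embedding Y Z g \<and>
           hausdorff_distance Z (f ` mspace X) (g ` mspace Y) \<le> r + e"
proof -
  let ?M = "Inl ` mspace X \<union> Inr ` mspace Y :: (real + real) set"
  define D where "D s t = (case s of Inl x \<Rightarrow> (case t of Inl x' \<Rightarrow> mdist X x x' | Inr y \<Rightarrow> \<bar>\<delta> x y\<bar> + e)
     | Inr y \<Rightarrow> (case t of Inl x \<Rightarrow> \<bar>\<delta> x y\<bar> + e | Inr y' \<Rightarrow> mdist Y y y'))" for s t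
  have [simp]: "D (Inl x) (Inl x') = mdist X x x'" "D (Inl x) (Inr y) = \<bar>\<delta> x y\<bar> + e"
     "D (Inr y) (Inl x) = \<bar>\<delta> x y\<bar> + e" "D (Inr y) (Inr y') = mdist Y y y'" for x x' y y'
    by (simp_all add: D_def)
  note cD = coupling_D[OF c]
  have M: "Metric_space ?M D"
  proof
    show "0 \<le> D s t" for s t using e by (cases s; cases t) auto
    show "D s t = D t s" for s t by (cases s; cases t) (auto simp: mdist_commute)
    show "D s t = 0 \<longleftrightarrow> s = t" if "s \<in> ?M" "t \<in> ?M" for s t
      using that e by (cases s; cases t) (auto simp: add_nonneg_eq_0_iff)
    show "D s u \<le> D s t + D t u" if "s \<in> ?M" "t \<in> ?M" "u \<in> ?M" for s t u
    proof (cases s; cases t; cases u)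
      fix x y x' assume "s = Inl x" "t = Inr y" "u = Inl x'"
      then show ?thesis using that e cD(3)[of x x' y] cD(1)[of x y] cD(1)[of x' y] by auto
    next
      fix x y x' assume "s = Inr x" "t = Inl y" "u = Inr x'"
      then show ?thesis using that e cD(5)[of y x x'] cD(1)[of y x] cD(1)[of y x'] by auto
    next
      fix x x' y assume "s = Inl x" "t = Inl x'" "u = Inr y"
      then show ?thesis using that cD(2)[of x x' y] cD(1)[of x y] cD(1)[of x' y] by auto
    next
      fix x y y' assume "s = Inl x" "t = Inr y" "u = Inr y'"
      then show ?thesis using that cD(4)[of x y' y] cD(1)[of x y] cD(1)[of x y'] by (auto simp: mdist_commute)
    next
      fix x x' y assume "s = Inr y" "t = Inl x" "u = Inl x'"
      then show ?thesis using that cD(2)[of x' x y] cD(1)[of x y] cD(1)[of x' y] by (auto simp: mdist_commute)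
    next
      fix x y y' assume "s = Inr y" "t = Inr y'" "u = Inl x"
      then show ?thesis using that cD(4)[of x y y'] cD(1)[of x y] cD(1)[of x y'] by auto
    qed (use that in \<open>auto simp: mdist_triangle\<close>)
  qed
  let ?W = "metric (?M, D)"
  have W[simp]: "mspace ?W = ?M" "mdist ?W = D"
    using M by (auto simp: Metric_space.mspace_metric Metric_space.mdist_metric)
  obtain h :: "real + real \<Rightarrow> real" where "inj h" using inj_real_sum by blast
  then obtain Z where Z: "mspace Z = h ` mspace ?W" "isometric_embedding ?W Z h"
    using isometric_image_metric[of h ?W] by (metis inj_on_subset subset_UNIV)
  have f: "isometric_embedding X Z (h \<circ> Inl)" and g: "isometric_embedding Y Z (h \<circ> Inr)"
    by (rule isometric_embedding_compose[OF _ Z(2)], simp add: isometric_embedding_def)+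
  have d: "mdist Z ((h \<circ> Inl) x) ((h \<circ> Inr) y) = \<delta> x y + e" if "x \<in> mspace X" "y \<in> mspace Y" for x y
    using isometric_embedding_D(2)[OF Z(2), of "Inl x" "Inr y"] that cD(1)[OF that] by simp
  have "hausdorff_distance Z ((h \<circ> Inl) ` mspace X) ((h \<circ> Inr) ` mspace Y) \<le> r + e"
  proof (rule hausdorff_distance_le)
    show "\<exists>b\<in>(h \<circ> Inr) ` mspace Y. mdist Z a b \<le> r + e" if "a \<in> (h \<circ> Inl) ` mspace X" for a
    proof -
      obtain x where x: "x \<in> mspace X" "a = (h \<circ> Inl) x" using \<open>a \<in> _\<close> by blast
      obtain y where y: "y \<in> mspace Y" "\<delta> x y < r" using cD(6)[OF x(1)] by blast
      show ?thesis using d[OF x(1) y(1)] x y by (intro bexI[of _ "(h \<circ> Inr) y"]) auto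
    qed
    show "\<exists>a\<in>(h \<circ> Inl) ` mspace X. mdist Z a b \<le> r + e" if "b \<in> (h \<circ> Inr) ` mspace Y" for b
    proof -
      obtain y where y: "y \<in> mspace Y" "b = (h \<circ> Inr) y" using \<open>b \<in> _\<close> by blast
      obtain x where x: "x \<in> mspace X" "\<delta> x y < r" using cD(7)[OF y(1)] by blast
      show ?thesis using d[OF x(1) y(1)] x y by (intro bexI[of _ "(h \<circ> Inl) x"]) auto
    qed
  qed (use ne in auto)
  then show ?thesis using f g by blast
qed


lemma gh_distance_less_imp_coupling:
  assumes X: "nonempty_compact X" and Y: "nonempty_compact Y" and less: "gh_distance X Y < r"
  shows "\<exists>\<delta>. coupling X Y r \<delta>"
proof -
  let ?S = "{hausdorff_distance Z (f ` mspace X) (g ` mspace Y) | (Z :: real metric) f g.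
            isometric_embedding X Z f \<and> isometric_embedding Y Z g}"
  have ne: "mspace X \<noteq> {}" "mspace Y \<noteq> {}" using X Y by (auto simp: nonempty_compact_def)
  obtain K where K: "K > 0" "\<And>x x'. x \<in> mspace X \<Longrightarrow> x' \<in> mspace X \<Longrightarrow> mdist X x x' \<le> K"
    using nonempty_compact_bounded[OF X] by metis
  obtain L where L: "L > 0" "\<And>x x'. x \<in> mspace Y \<Longrightarrow> x' \<in> mspace Y \<Longrightarrow> mdist Y x x' \<le> L"
    using nonempty_compact_bounded[OF Y] by metis
  have "coupling X Y (K + L + 1) (\<lambda>x y. K + L)"
    unfolding coupling_def using K L ne
    by (auto simp: add_nonneg_nonneg intro: add_increasing order_trans[OF K(2)] order_trans[OF L(2)])
  from ambient_of_coupling[OF ne this zero_less_one] have "?S \<noteq> {}" by blast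
  then obtain v where "v \<in> ?S" "v < r"
    using less cInf_lessD[of ?S r] unfolding gh_distance_def by blast
  then show ?thesis using coupling_of_ambient(2)[OF X Y] by blast
qed

lemma gh_distance_bdd_below:
  assumes X: "nonempty_compact X" and Y: "nonempty_compact Y"
  shows "bdd_below {hausdorff_distance Z (f ` mspace X) (g ` mspace Y) | (Z :: real metric) f g.
            isometric_embedding X Z f \<and> isometric_embedding Y Z g}"
  by (rule bdd_belowI[of _ 0]) (use coupling_of_ambient(1)[OF X Y] in blast)

lemma coupling_imp_gh_distance_le:
  assumes X: "nonempty_compact X" and Y: "nonempty_compact Y" and c: "coupling X Y r \<delta>"
  shows "gh_distance X Y \<le> r"
proof (rule field_le_epsilon)
  fix e :: real assume "e > 0"
  moreover have "mspace X \<noteq> {}" "mspace Y \<noteq> {}" using X Y by (auto simp: nonempty_compact_def)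
  ultimately obtain Z :: "real metric" and f g where
    "isometric_embedding X Z f" "isometric_embedding Y Z g"
    and le: "hausdorff_distance Z (f ` mspace X) (g ` mspace Y) \<le> r + e"
    using ambient_of_coupling[OF _ _ c] by blast
  then have "gh_distance X Y \<le> hausdorff_distance Z (f ` mspace X) (g ` mspace Y)"
    unfolding gh_distance_def by (intro cInf_lower gh_distance_bdd_below[OF X Y]) blast
  then show "gh_distance X Y \<le> r + e" using le by linarith
qed

lemma gh_distance_le_hausdorff_distance:
  fixes X Y :: "real metric" and Z :: "'c metric"
  assumes "nonempty_compact X" "nonempty_compact Y"
    and "isometric_embedding X Z f" "isometric_embedding Y Z g"
  shows "gh_distance X Y \<le> hausdorff_distance Z (f ` mspace X) (g ` mspace Y)"
  using coupling_of_ambient(2)[OF assms] coupling_imp_gh_distance_le[OF assms(1,2)]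
  by (blast intro: dense_ge)

section \<open>Every compact metric space has an isometric copy over the reals\<close>

lemma nonempty_compact_real_copy:
  fixes X :: "'a metric"
  assumes X: "nonempty_compact X"
  shows "\<exists>X' :: real metric. isometric X X'"
proof -
  interpret M: Metric_space "mspace X" "mdist X" by simp
  have "M.mtotally_bounded (mspace X)"
    using X M.compactin_imp_mtotally_bounded
    by (simp add: nonempty_compact_def compact_space_def mtopology_of_def)
  then have "\<forall>n::nat. \<exists>K. finite K \<and> K \<subseteq> mspace X \<and> mspace X \<subseteq> (\<Union>x\<in>K. M.mball x (1 / Suc n))"
    by (simp add: M.mtotally_bounded_def)
  then obtain K where K: "\<And>n::nat. finite (K n)" "\<And>n. K n \<subseteq> mspace X"
      "\<And>n. mspace X \<subseteq> (\<Union>x\<in>K n. M.mball x (1 / Suc n))"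
    by metis
  define D where "D = (\<Union>n. K n) \<times> (UNIV :: nat set)"
  have "countable D" unfolding D_def by (intro countable_SIGMA countable_UN) (simp_all add: K(1) countable_finite)
  then obtain c :: "'a \<times> nat \<Rightarrow> nat" where c: "inj_on c D" by (auto simp: countable_def)
  define \<Phi> where "\<Phi> x = c ` {(s, n). (s, n) \<in> D \<and> mdist X x s < 1 / Suc n}" for x
  have inj: "inj_on \<Phi> (mspace X)"
  proof (rule inj_onI, rule ccontr)
    fix x y assume x: "x \<in> mspace X" and y: "y \<in> mspace X" and eq: "\<Phi> x = \<Phi> y" and "x \<noteq> y"
    then have "0 < mdist X x y / 2" by simp
    then obtain n where n: "1 / real (Suc n) < mdist X x y / 2"
      using nat_approx_posE by blast
    obtain s where s: "s \<in> K n" "s \<in> mspace X" "mdist X s x < 1 / Suc n"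
      using K(3)[of n] x by auto
    have "(s, n) \<in> {(s, n). (s, n) \<in> D \<and> mdist X x s < 1 / Suc n}"
      using s by (auto simp: D_def mdist_commute)
    also have "{(s, n). (s, n) \<in> D \<and> mdist X x s < 1 / Suc n} = {(s, n). (s, n) \<in> D \<and> mdist X y s < 1 / Suc n}"
      by (rule inj_on_image_eq_iff[OF c, THEN iffD1]) (use eq in \<open>auto simp: \<Phi>_def\<close>)
    finally have "mdist X y s < 1 / Suc n" by auto
    then have "mdist X x y < mdist X x y"
      using mdist_triangle[OF x s(2) y] s(3) n by (simp add: mdist_commute)
    then show False by simp
  qed
  obtain \<psi> :: "nat set \<Rightarrow> real" where "inj \<psi>"
    using nat_sets_eqpoll_reals by (metis bij_betw_imp_inj_on eqpoll_def)
  then have "inj_on (\<psi> \<circ> \<Phi>) (mspace X)"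
    using inj by (meson comp_inj_on inj_on_subset subset_UNIV)
  from isometric_image_metric[OF this] show ?thesis unfolding isometric_def by metis
qed

section \<open>The Gromov--Hausdorff distance is a metric up to isometry\<close>

lemma gh_distance_nonneg:
  assumes "nonempty_compact X" "nonempty_compact Y" shows "0 \<le> gh_distance X Y"
proof (rule ccontr)
  assume "\<not> ?thesis"
  then obtain \<delta> where c: "coupling X Y 0 \<delta>"
    using gh_distance_less_imp_coupling[OF assms] by fastforce
  obtain x where "x \<in> mspace X" using assms by (auto simp: nonempty_compact_def)
  then show False using coupling_D(1,6)[OF c] by fastforce
qed

lemma gh_distance_commute:
  assumes X: "nonempty_compact X" and Y: "nonempty_compact Y"
  shows "gh_distance X Y = gh_distance Y X"
proof (rule antisym)
  show "gh_distance X Y \<le> gh_distance Y X"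
    using gh_distance_less_imp_coupling[OF Y X] coupling_imp_gh_distance_le[OF X Y] coupling_sym
    by (metis dense_ge)
  show "gh_distance Y X \<le> gh_distance X Y"
    using gh_distance_less_imp_coupling[OF X Y] coupling_imp_gh_distance_le[OF Y X] coupling_sym
    by (metis dense_ge)
qed

lemma coupling_compose:
  assumes c: "coupling X Y r \<delta>" and c': "coupling Y W s \<delta>'" and ne: "mspace Y \<noteq> {}"
  shows "coupling X W (r + s) (\<lambda>x w. INF y\<in>mspace Y. \<delta> x y + \<delta>' y w)"
proof -
  let ?d = "\<lambda>x w. INF y\<in>mspace Y. \<delta> x y + \<delta>' y w"
  note d = coupling_D[OF c] and d' = coupling_D[OF c']
  have low: "?d x w \<le> \<delta> x y + \<delta>' y w" if "x \<in> mspace X" "y \<in> mspace Y" "w \<in> mspace W" for x y w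
    using that d(1) d'(1) by (intro cINF_lower bdd_belowI2[of _ 0]) auto
  have great: "m \<le> ?d x w" if "\<And>y. y \<in> mspace Y \<Longrightarrow> m \<le> \<delta> x y + \<delta>' y w" for m x w
    using that ne by (intro cINF_greatest) auto
  show ?thesis
    unfolding coupling_def
  proof (intro conjI ballI)
    fix x w assume "x \<in> mspace X" "w \<in> mspace W"
    then show "0 \<le> ?d x w" using d(1) d'(1) by (intro great) auto
  next
    fix x x' w assume a: "x \<in> mspace X" "x' \<in> mspace X" "w \<in> mspace W"
    have "?d x w - mdist X x x' \<le> ?d x' w"
    proof (rule great)
      fix y assume "y \<in> mspace Y"
      then show "?d x w - mdist X x x' \<le> \<delta> x' y + \<delta>' y w"
        using low[of x y w] d(2)[of x x' y] a by auto
    qed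
    then show "?d x w \<le> mdist X x x' + ?d x' w" by linarith
    have "mdist X x x' - ?d x' w \<le> ?d x w"
    proof (rule great)
      fix y assume y: "y \<in> mspace Y"
      have "mdist X x x' - (\<delta> x y + \<delta>' y w) \<le> ?d x' w"
      proof (rule great)
        fix y' assume y': "y' \<in> mspace Y"
        show "mdist X x x' - (\<delta> x y + \<delta>' y w) \<le> \<delta> x' y' + \<delta>' y' w"
          using d(3)[of x x' y] d(4)[of x' y y'] d'(3)[of y y' w] a y y' by auto
      qed
      then show "mdist X x x' - ?d x' w \<le> \<delta> x y + \<delta>' y w" by linarith
    qed
    then show "mdist X x x' \<le> ?d x w + ?d x' w" by linarith
  next
    fix x w w' assume a: "x \<in> mspace X" "w \<in> mspace W" "w' \<in> mspace W"
    have "?d x w - mdist W w w' \<le> ?d x w'"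
    proof (rule great)
      fix y assume "y \<in> mspace Y"
      then show "?d x w - mdist W w w' \<le> \<delta> x y + \<delta>' y w'"
        using low[of x y w] d'(4)[of y w w'] a by auto
    qed
    then show "?d x w \<le> ?d x w' + mdist W w w'" by linarith
    have "mdist W w w' - ?d x w' \<le> ?d x w"
    proof (rule great)
      fix y assume y: "y \<in> mspace Y"
      have "mdist W w w' - (\<delta> x y + \<delta>' y w) \<le> ?d x w'"
      proof (rule great)
        fix y' assume y': "y' \<in> mspace Y"
        show "mdist W w w' - (\<delta> x y + \<delta>' y w) \<le> \<delta> x y' + \<delta>' y' w'"
          using d'(5)[of y w w'] d'(2)[of y y' w'] d(5)[of x y y'] a y y' by auto
      qed
      then show "mdist W w w' - ?d x w' \<le> \<delta> x y + \<delta>' y w" by linarith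
    qed
    then show "mdist W w w' \<le> ?d x w + ?d x w'" by linarith
  next
    fix x assume x: "x \<in> mspace X"
    obtain y where y: "y \<in> mspace Y" "\<delta> x y < r" using d(6)[OF x] by blast
    obtain w where w: "w \<in> mspace W" "\<delta>' y w < s" using d'(6)[OF y(1)] by blast
    show "\<exists>w\<in>mspace W. ?d x w < r + s" using low[OF x y(1) w(1)] y w by (intro bexI[of _ w]) auto
  next
    fix w assume w: "w \<in> mspace W"
    obtain y where y: "y \<in> mspace Y" "\<delta>' y w < s" using d'(7)[OF w] by blast
    obtain x where x: "x \<in> mspace X" "\<delta> x y < r" using d(7)[OF y(1)] by blast
    show "\<exists>x\<in>mspace X. ?d x w < r + s" using low[OF x(1) y(1) w] y x by (intro bexI[of _ x]) auto
  qed
qed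

lemma gh_distance_triangle:
  assumes X: "nonempty_compact X" and Y: "nonempty_compact Y" and W: "nonempty_compact W"
  shows "gh_distance X W \<le> gh_distance X Y + gh_distance Y W"
proof (rule field_le_epsilon)
  fix e :: real assume "e > 0"
  then obtain \<delta> \<delta>' where "coupling X Y (gh_distance X Y + e / 2) \<delta>" "coupling Y W (gh_distance Y W + e / 2) \<delta>'"
    using gh_distance_less_imp_coupling[OF X Y] gh_distance_less_imp_coupling[OF Y W]
    by (metis half_gt_zero less_add_same_cancel1)
  from coupling_imp_gh_distance_le[OF X W coupling_compose[OF this]] Y
  show "gh_distance X W \<le> gh_distance X Y + gh_distance Y W + e"
    by (simp add: nonempty_compact_def)
qed

lemma isometric_imp_gh_distance_eq_0:
  assumes X: "nonempty_compact X" and Y: "nonempty_compact Y" and iso: "isometric X Y"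
  shows "gh_distance X Y = 0"
proof (rule antisym)
  obtain f where f: "isometric_embedding X Y f" and im: "f ` mspace X = mspace Y"
    using iso by (auto simp: isometric_def)
  have "gh_distance X Y \<le> hausdorff_distance Y (f ` mspace X) (id ` mspace Y)"
    by (rule gh_distance_le_hausdorff_distance[OF X Y f]) (simp add: isometric_embedding_def)
  also have "\<dots> \<le> 0"
  proof (rule hausdorff_distance_le)
    have "\<exists>b\<in>mspace Y. mdist Y a b \<le> 0" "\<exists>b\<in>mspace Y. mdist Y b a \<le> 0" if "a \<in> mspace Y" for a
      using that by (auto intro!: bexI[of _ a] simp: mdist_zero[THEN iffD2])
    then show "a \<in> f ` mspace X \<Longrightarrow> \<exists>b\<in>id ` mspace Y. mdist Y a b \<le> 0"
      "b \<in> id ` mspace Y \<Longrightarrow> \<exists>a\<in>f ` mspace X. mdist Y a b \<le> 0" for a b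
      by (simp_all add: im)
  qed (use X Y in \<open>auto simp: nonempty_compact_def\<close>)
  finally show "gh_distance X Y \<le> 0" .
qed (rule gh_distance_nonneg[OF X Y])

lemma gh_distance_cong:
  assumes "nonempty_compact X" "nonempty_compact X'" "isometric X X'"
    and "nonempty_compact Y" "nonempty_compact Y'" "isometric Y Y'"
  shows "gh_distance X Y = gh_distance X' Y'"
proof -
  have le: "gh_distance A B \<le> gh_distance A' B'"
    if "nonempty_compact A" "nonempty_compact A'" "isometric A A'"
       "nonempty_compact B" "nonempty_compact B'" "isometric B B'" for A A' B B' :: "real metric"
    using that gh_distance_triangle[of A A' B] gh_distance_triangle[of A' B' B]
      isometric_imp_gh_distance_eq_0[of A A'] isometric_imp_gh_distance_eq_0[of B' B] isometric_sym[of B B']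
    by simp
  show ?thesis using le[of X X' Y Y'] le[of X' X Y' Y] assms isometric_sym by (metis antisym)
qed

lemma gh_distance_0_imp_isometric_embedding:
  assumes X: "nonempty_compact X" and Y: "nonempty_compact Y" and zero: "gh_distance X Y = 0"
  shows "\<exists>f. isometric_embedding X Y f"
proof -
  let ?T = "product_topology (\<lambda>x. mtopology_of Y) (mspace X)"
  define C where "C n = {\<phi> \<in> topspace ?T. \<forall>x\<in>mspace X. \<forall>x'\<in>mspace X.
    \<bar>mdist Y (\<phi> x) (\<phi> x') - mdist X x x'\<bar> \<le> 2 / real (Suc n)}" for n :: nat
  have "(\<Inter>n. C n) \<noteq> {}"
  proof (rule compact_space_imp_nest)
    show "compact_space ?T" using Y by (simp add: compact_space_product_topology nonempty_compact_def)
    show "closedin ?T (C n)" for n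
    proof -
      have cl: "closedin ?T {\<phi> \<in> topspace ?T. \<bar>mdist Y (\<phi> x) (\<phi> x') - mdist X x x'\<bar> \<in> {..2 / real (Suc n)}}"
        if "x \<in> mspace X" "x' \<in> mspace X" for x x'
      proof (rule closedin_continuous_map_preimage[where Y = euclidean])
        have "continuous_map ?T euclidean (\<lambda>\<phi>. mdist Y (\<phi> x) (\<phi> x'))"
          using that by (intro continuous_map_mdist continuous_map_product_projection)
        then show "continuous_map ?T euclidean (\<lambda>\<phi>. \<bar>mdist Y (\<phi> x) (\<phi> x') - mdist X x x'\<bar>)"
          by (intro continuous_map_real_abs continuous_map_diff continuous_map_const[THEN iffD2]) auto
      qed simp
      have ne: "mspace X \<noteq> {}" using X by (simp add: nonempty_compact_def)
      have "C n = (\<Inter>x\<in>mspace X. \<Inter>x'\<in>mspace X.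
         {\<phi> \<in> topspace ?T. \<bar>mdist Y (\<phi> x) (\<phi> x') - mdist X x x'\<bar> \<in> {..2 / real (Suc n)}})"
        unfolding C_def using ne by fastforce
      also have "closedin ?T \<dots>"
        using ne cl by (intro closedin_INT) auto
      finally show ?thesis .
    qed
    show "C n \<noteq> {}" for n
    proof -
      have "gh_distance X Y < 1 / real (Suc n)" by (simp add: zero)
      then obtain \<delta> where c: "coupling X Y (1 / real (Suc n)) \<delta>"
        using gh_distance_less_imp_coupling[OF X Y] by blast
      note d = coupling_D[OF c]
      obtain \<phi> where \<phi>: "\<And>x. x \<in> mspace X \<Longrightarrow> \<phi> x \<in> mspace Y" "\<And>x. x \<in> mspace X \<Longrightarrow> \<delta> x (\<phi> x) < 1 / real (Suc n)"
        using d(6) by metis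
      have "\<bar>mdist Y (\<phi> x) (\<phi> x') - mdist X x x'\<bar> \<le> 2 / real (Suc n)"
        if x: "x \<in> mspace X" and x': "x' \<in> mspace X" for x x'
      proof -
        have "mdist Y (\<phi> x) (\<phi> x') \<le> \<delta> x (\<phi> x) + \<delta> x (\<phi> x')" "\<delta> x (\<phi> x') \<le> mdist X x x' + \<delta> x' (\<phi> x')"
          "mdist X x x' \<le> \<delta> x (\<phi> x') + \<delta> x' (\<phi> x')" "\<delta> x (\<phi> x') \<le> \<delta> x (\<phi> x) + mdist Y (\<phi> x') (\<phi> x)"
          using d(5)[OF x \<phi>(1)[OF x] \<phi>(1)[OF x']] d(2)[OF x x' \<phi>(1)[OF x']] d(3)[OF x x' \<phi>(1)[OF x']]
            d(4)[OF x \<phi>(1)[OF x'] \<phi>(1)[OF x]] by auto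
        moreover have "2 / real (Suc n) = 1 / real (Suc n) + 1 / real (Suc n)" by simp
        ultimately show ?thesis
          using \<phi>(2)[OF x] \<phi>(2)[OF x'] mdist_commute[of Y "\<phi> x" "\<phi> x'"] unfolding abs_le_iff by linarith
      qed
      then have "restrict \<phi> (mspace X) \<in> C n" using \<phi>(1) by (auto simp: C_def)
      then show ?thesis by blast
    qed
    show "decseq C"
    proof (rule decseq_SucI)
      fix n
      have "2 / real (Suc (Suc n)) \<le> 2 / real (Suc n)" by (simp add: field_simps)
      then show "C (Suc n) \<subseteq> C n" unfolding C_def by (blast intro: order_trans)
    qed
  qed
  then obtain \<phi> where \<phi>: "\<And>n. \<phi> \<in> C n" by auto
  have "mdist Y (\<phi> x) (\<phi> x') = mdist X x x'" if "x \<in> mspace X" "x' \<in> mspace X" for x x'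
  proof (rule ccontr)
    assume "\<not> ?thesis"
    then have "0 < \<bar>mdist Y (\<phi> x) (\<phi> x') - mdist X x x'\<bar> / 2" by simp
    then obtain n where "1 / real (Suc n) < \<bar>mdist Y (\<phi> x) (\<phi> x') - mdist X x x'\<bar> / 2"
      using nat_approx_posE by blast
    moreover have "\<bar>mdist Y (\<phi> x) (\<phi> x') - mdist X x x'\<bar> \<le> 2 / real (Suc n)"
      using \<phi>[of n] that by (simp add: C_def)
    ultimately show False by simp
  qed
  moreover have "\<phi> \<in> mspace X \<rightarrow> mspace Y" using \<phi>[of 0] by (auto simp: C_def)
  ultimately have "isometric_embedding X Y \<phi>" by (simp add: isometric_embedding_def)
  then show ?thesis by blast
qed

lemma self_isometric_embedding_surj:
  assumes X: "nonempty_compact X" and h: "isometric_embedding X X h"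
  shows "h ` mspace X = mspace X"
proof (rule ccontr)
  assume "h ` mspace X \<noteq> mspace X"
  then obtain x where x: "x \<in> mspace X" "x \<notin> h ` mspace X"
    using isometric_embedding_D(1)[OF h] by blast
  interpret M: Metric_space "mspace X" "mdist X" by simp
  interpret MM: Metric_space12 "mspace X" "mdist X" "mspace X" "mdist X"
    by (rule Metric_space12_mspace_mdist)
  have cs: "compact_space M.mtopology" using X by (simp add: nonempty_compact_def mtopology_of_def)
  have "embedding_map M.mtopology M.mtopology h"
    using MM.isometry_imp_embedding_map[of h] h by (simp add: isometric_embedding_def)
  then have "continuous_map M.mtopology M.mtopology h"
    by (auto simp: embedding_map_def dest!: homeomorphic_imp_continuous_map
        intro: continuous_map_into_fulltopology)
  then have "compactin M.mtopology (h ` mspace X)"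
    using cs image_compactin[of M.mtopology "mspace X"] by (simp add: compact_space_def)
  then have "closedin M.mtopology (h ` mspace X)"
    by (intro compactin_imp_closedin M.Hausdorff_space_mtopology)
  then obtain e where e: "e > 0" "disjnt (h ` mspace X) (M.mball x e)"
    using x by (metis M.closedin_metric DiffI)
  have far: "e \<le> mdist X x (h y)" if "y \<in> mspace X" for y
    using e(2) that x(1) isometric_embedding_D(1)[OF h that] by (force simp: disjnt_iff)
  have mem: "(h ^^ n) y \<in> mspace X" if "y \<in> mspace X" for n y
    by (induction n) (use that isometric_embedding_D(1)[OF h] in auto)
  have sep: "e \<le> mdist X ((h ^^ n) x) ((h ^^ (n + Suc k)) x)" for n k
  proof (induction n)
    case 0 show ?case using far[OF mem[OF x(1), of k]] by simp
  next
    case (Suc n)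
    then show ?case
      using isometric_embedding_D(2)[OF h mem[OF x(1), of n] mem[OF x(1), of "n + Suc k"]] by simp
  qed
  obtain l r where lr: "l \<in> mspace X" "strict_mono (r :: nat \<Rightarrow> nat)"
      "limitin M.mtopology ((\<lambda>n. (h ^^ n) x) \<circ> r) l sequentially"
    using cs mem[OF x(1)] unfolding M.compact_space_sequentially by (meson image_subsetI)
  then obtain N where N: "\<And>n. n \<ge> N \<Longrightarrow> mdist X ((h ^^ (r n)) x) l < e / 2"
    using e(1) unfolding M.limit_metric_sequentially by (metis comp_apply half_gt_zero)
  obtain k where k: "r (Suc N) = r N + Suc k"
    using lr(2) by (metis strict_mono_Suc_iff less_imp_Suc_add add_Suc_right)
  have "mdist X ((h ^^ r N) x) ((h ^^ r (Suc N)) x) < e"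
    using N[of N] N[of "Suc N"] mdist_triangle[OF mem[OF x(1)] lr(1) mem[OF x(1)], of "r N" "r (Suc N)"]
    by (simp add: mdist_commute)
  then show False using sep[of "r N" k] k by simp
qed

lemma gh_distance_0_imp_isometric:
  assumes X: "nonempty_compact X" and Y: "nonempty_compact Y" and zero: "gh_distance X Y = 0"
  shows "isometric X Y"
proof -
  obtain f where f: "isometric_embedding X Y f"
    using gh_distance_0_imp_isometric_embedding[OF X Y zero] by blast
  obtain g where g: "isometric_embedding Y X g"
    using gh_distance_0_imp_isometric_embedding[OF Y X] zero gh_distance_commute[OF X Y] by metis
  have "(f \<circ> g) ` mspace Y = mspace Y"
    by (rule self_isometric_embedding_surj[OF Y isometric_embedding_compose[OF g f]])
  then have "mspace Y \<subseteq> f ` mspace X"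
    using isometric_embedding_D(1)[OF g] by auto
  then have "f ` mspace X = mspace Y"
    using isometric_embedding_D(1)[OF f] by blast
  then show ?thesis using f by (auto simp: isometric_def)
qed

section \<open>The Gromov--Hausdorff space\<close>

text \<open>
  The elements are isometry classes of nonempty compact metric spaces. Metric spaces with points
  in \<^typ>\<open>real\<close> represent all of these classes, by \<open>nonempty_compact_real_copy\<close>.
\<close>

quotient_type gh_space = "real metric" / partial:
    "\<lambda>X Y. nonempty_compact X \<and> nonempty_compact Y \<and> isometric X Y"
proof (rule part_equivpI)
  have "nonempty_compact (metric ({0::real}, dist))"
    unfolding nonempty_compact_def
    by (simp add: Met_TC.subspace Metric_space.mspace_metric Metric_space.mtopology_of
        Metric_space.topspace_mtopology compact_space_def finite_imp_compactin)
  then show "\<exists>X::real metric. nonempty_compact X \<and> nonempty_compact X \<and> isometric X X"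
    using isometric_refl by blast
  show "symp (\<lambda>X Y :: real metric. nonempty_compact X \<and> nonempty_compact Y \<and> isometric X Y)"
    by (auto intro!: sympI isometric_sym)
  show "transp (\<lambda>X Y :: real metric. nonempty_compact X \<and> nonempty_compact Y \<and> isometric X Y)"
    by (auto intro!: transpI intro: isometric_trans)
qed

instantiation gh_space :: metric_space
begin

lift_definition dist_gh_space :: "gh_space \<Rightarrow> gh_space \<Rightarrow> real" is gh_distance
  using gh_distance_cong by blast

definition uniformity_gh_space :: "(gh_space \<times> gh_space) filter" where
  "uniformity_gh_space = (INF e\<in>{0<..}. principal {(x, y). dist x y < e})"

definition open_gh_space :: "gh_space set \<Rightarrow> bool" where
  "open_gh_space U \<longleftrightarrow> (\<forall>x\<in>U. eventually (\<lambda>(x', y). x' = x \<longrightarrow> y \<in> U) uniformity)"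

instance
proof
  fix x y z :: gh_space
  show "dist x y = 0 \<longleftrightarrow> x = y"
    by transfer (use gh_distance_0_imp_isometric isometric_imp_gh_distance_eq_0 in blast)
  show "dist x y \<le> dist x z + dist y z"
    by transfer (metis gh_distance_triangle gh_distance_commute)
qed (simp_all add: uniformity_gh_space_def open_gh_space_def)

end

section \<open>Perfect spaces and Baire category\<close>

definition perfect_metric :: "'a metric \<Rightarrow> bool" where
  "perfect_metric X \<longleftrightarrow> \<not> (\<exists>x\<in>mspace X. openin (mtopology_of X) {x})"

lemma isometric_perfect_metric:
  assumes "isometric X Y" "perfect_metric X" shows "perfect_metric Y"
proof -
  obtain f where f: "isometric_embedding X Y f" and im: "f ` mspace X = mspace Y"
    using assms by (auto simp: isometric_def)
  interpret Metric_space12 "mspace X" "mdist X" "mspace Y" "mdist Y"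
    by (rule Metric_space12_mspace_mdist)
  have hom: "homeomorphic_map (mtopology_of X) (mtopology_of Y) f"
    unfolding mtopology_of_def using isometry_imp_homeomorphic_map[OF im] f
    by (auto simp: isometric_embedding_def)
  have *: "openin (mtopology_of X) {x}" if "x \<in> mspace X" "openin (mtopology_of Y) {f x}" for x
    using homeomorphic_map_openness[OF hom, of "{x}"] that by simp
  show ?thesis
    unfolding perfect_metric_def
  proof clarify
    fix y assume "y \<in> mspace Y" and op: "openin (mtopology_of Y) {y}"
    then obtain x where "x \<in> mspace X" "y = f x" using im by auto
    with * op assms(2) show False by (auto simp: perfect_metric_def)
  qed
qed

lift_definition gh_perfect :: "gh_space \<Rightarrow> bool" is perfect_metric
proof -
  fix X Y :: "real metric"
  assume "nonempty_compact X \<and> nonempty_compact Y \<and> isometric X Y"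
  then have "isometric X Y" "isometric Y X" by (simp_all add: isometric_sym)
  then show "perfect_metric X = perfect_metric Y"
    using isometric_perfect_metric[of X Y] isometric_perfect_metric[of Y X] by blast
qed

definition rare :: "'a::topological_space set \<Rightarrow> bool" where
  "rare S \<longleftrightarrow> interior (closure S) = {}"

definition meager :: "'a::topological_space set \<Rightarrow> bool" where
  "meager S \<longleftrightarrow> (\<exists>\<F>. countable \<F> \<and> (\<forall>T\<in>\<F>. rare T) \<and> S = \<Union>\<F>)"

definition residual :: "'a::topological_space set \<Rightarrow> bool" where
  "residual S \<longleftrightarrow> meager (- S)"

end

theory Submission
  imports Defs
begin

text \<open>
  A space fails to be perfect iff for some \<open>r > 0\<close> it has an \<open>r\<close>-separated point, that is, one whose
  distance to every other point is at least \<open>r\<close>. For fixed \<open>r\<close> such spaces form a rare set: any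
  \<open>X\<close> is at distance at most \<open>s\<close> from the product \<open>X \<times> {0, s}\<close>, in which each point
  has a partner at distance exactly \<open>s\<close>. When \<open>2 s \<le> r\<close>, every space closer than \<open>s / 4\<close> to this
  product inherits, for each point, a partner at distance strictly between \<open>0\<close> and \<open>r\<close>.
\<close>

definition separated_point :: "'a metric \<Rightarrow> real \<Rightarrow> 'a \<Rightarrow> bool" where
  "separated_point X r x \<longleftrightarrow> x \<in> mspace X \<and> (\<forall>x'\<in>mspace X. x' \<noteq> x \<longrightarrow> r \<le> mdist X x x')"

text \<open>An isolated point is alone in some ball, whose radius can be shrunk to
  \<open>1 / real (Suc n)\<close>. Restricting to these radii makes the family of sets of
  non-perfect spaces countable.\<close>

lemma not_perfect_metric_iff:
  "\<not> perfect_metric X \<longleftrightarrow> (\<exists>n x. separated_point X (1 / real (Suc n)) x)"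
proof -
  interpret M: Metric_space "mspace X" "mdist X" by simp
  have "openin (mtopology_of X) {x} \<longleftrightarrow> (\<exists>n. separated_point X (1 / real (Suc n)) x)"
    if x: "x \<in> mspace X" for x
  proof
    assume "openin (mtopology_of X) {x}"
    then obtain r where r: "r > 0" "M.mball x r \<subseteq> {x}"
      unfolding mtopology_of_def M.openin_mtopology by auto
    obtain n where "1 / real (Suc n) < r"
      using nat_approx_posE[OF r(1)] by blast
    then have "separated_point X (1 / real (Suc n)) x"
      using r(2) x by (force simp: separated_point_def)
    then show "\<exists>n. separated_point X (1 / real (Suc n)) x" by blast
  next
    assume "\<exists>n. separated_point X (1 / real (Suc n)) x"
    then obtain n where "separated_point X (1 / real (Suc n)) x" ..
    then have "M.mball x (1 / real (Suc n)) \<subseteq> {x}"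
      by (force simp: separated_point_def)
    then show "openin (mtopology_of X) {x}"
      unfolding mtopology_of_def M.openin_mtopology using x
      by (auto intro!: exI[of _ "1 / real (Suc n)"])
  qed
  then show ?thesis
    unfolding perfect_metric_def by (metis separated_point_def)
qed

lemma nonempty_compact_doubling:
  fixes X :: "real metric"
  assumes X: "nonempty_compact X" and s: "s > 0"
  obtains Y :: "real metric" where "nonempty_compact Y" "gh_distance X Y \<le> s"
    "\<And>y. y \<in> mspace Y \<Longrightarrow> \<exists>y'\<in>mspace Y. mdist Y y y' = s"
proof -
  define B where "B = submetric euclidean_metric {0, s}"
  define P where "P = prod_metric X B"
  have mB: "mspace B = {0, s}" and dB: "mdist B = dist"
    by (simp_all add: B_def)
  have mP: "mspace P = mspace X \<times> {0, s}" by (simp add: P_def mB)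
  have dP: "mdist P (x, a) (y, b) = sqrt ((mdist X x y)\<^sup>2 + (dist a b)\<^sup>2)" for x y a b
    by (simp add: P_def prod_dist_def dB)
  have "compact_space (mtopology_of B)"
    by (simp add: compact_space_def finite_imp_compactin mB)
  then have cP: "nonempty_compact P"
    using X by (simp add: nonempty_compact_def P_def mB compact_space_prod_topology)
  \<comment> \<open>The points of \<open>P\<close> are pairs, while \<open>gh_space\<close> is built
    from metrics on reals, so \<open>P\<close> is replaced by an isometric copy.\<close>
  obtain Y :: "real metric" where "isometric P Y"
    using nonempty_compact_real_copy[OF cP] by blast
  then have cY: "nonempty_compact Y"
    using cP isometric_nonempty_compact by blast
  obtain g where g: "isometric_embedding Y P g" "g ` mspace Y = mspace P"
    using isometric_sym[OF \<open>isometric P Y\<close>] by (auto simp: isometric_def)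
  have f: "isometric_embedding X P (\<lambda>x. (x, 0))"
    by (auto simp: isometric_embedding_def mP dP)
  show thesis
  proof
    \<comment> \<open>\<open>P\<close> itself is the ambient space: \<open>X\<close> becomes the
      slice at height 0 and \<open>Y\<close> fills all of \<open>P\<close>, so moving vertically
      costs at most \<open>s\<close>.\<close>
    have "gh_distance X Y \<le> hausdorff_distance P ((\<lambda>x. (x, 0)) ` mspace X) (g ` mspace Y)"
      by (rule gh_distance_le_hausdorff_distance[OF X cY f g(1)])
    also have "\<dots> \<le> s"
    proof (rule hausdorff_distance_le)
      have close: "mdist P (x, 0) (x, a) \<le> s" if "x \<in> mspace X" "a \<in> {0, s}" for x a
        using that s by (auto simp: dP mdist_zero[THEN iffD2])
      show "\<exists>b\<in>g ` mspace Y. mdist P a b \<le> s" if a: "a \<in> (\<lambda>x. (x, 0)) ` mspace X" for a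
        using a close unfolding g(2) mP by blast
      show "\<exists>a\<in>(\<lambda>x. (x, 0)) ` mspace X. mdist P a b \<le> s" if b: "b \<in> g ` mspace Y" for b
        using b close unfolding g(2) mP by blast
    qed (use X cY in \<open>auto simp: nonempty_compact_def\<close>)
    finally show "gh_distance X Y \<le> s" .
    show "\<exists>y'\<in>mspace Y. mdist Y y y' = s" if y: "y \<in> mspace Y" for y
    proof -
      obtain x a where xa: "g y = (x, a)" "x \<in> mspace X" "a \<in> {0, s}"
        using g(2) y mP by blast
      \<comment> \<open>The map sending \<open>a\<close> to \<open>s - a\<close> swaps the two
        heights 0 and \<open>s\<close>.\<close>
      then have "(x, s - a) \<in> mspace P" by (auto simp: mP)
      then obtain y' where y': "y' \<in> mspace Y" "g y' = (x, s - a)"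
        using g(2) by (metis imageE)
      have "mdist Y y y' = mdist P (x, a) (x, s - a)"
        using isometric_embedding_D(2)[OF g(1) y y'(1)] xa y' by simp
      also have "\<dots> = s" using xa(2,3) s by (auto simp: dP dist_real_def mdist_zero[THEN iffD2])
      finally show ?thesis using y' by blast
    qed
  qed (rule cY)
qed

text \<open>Go from \<open>w\<close> to a close \<open>y\<close>, on to its partner
  \<open>y'\<close>, and back to a close \<open>w'\<close>. The detour costs less than
  \<open>s/4 + s + s/4\<close>, which is below \<open>2 * s\<close>, so separation forces
  \<open>w' = w\<close>. But then \<open>y\<close> and \<open>y'\<close> are both within
  \<open>s/4\<close> of \<open>w\<close>, although they are \<open>s\<close> apart.\<close>

lemma no_separated_point_near:
  assumes Y: "nonempty_compact Y" and W: "nonempty_compact W"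
    and near: "gh_distance Y W < s / 4" and s: "2 * s \<le> r"
    and partner: "\<And>y. y \<in> mspace Y \<Longrightarrow> \<exists>y'\<in>mspace Y. mdist Y y y' = s"
  shows "\<not> separated_point W r w"
proof
  assume sep: "separated_point W r w"
  then have w: "w \<in> mspace W" by (simp add: separated_point_def)
  obtain \<delta> where c: "coupling Y W (s / 4) \<delta>"
    using gh_distance_less_imp_coupling[OF Y W near] by blast
  note d = coupling_D[OF c]
  obtain y where y: "y \<in> mspace Y" "\<delta> y w < s / 4" using d(7)[OF w] by blast
  obtain y' where y': "y' \<in> mspace Y" "mdist Y y y' = s" using partner[OF y(1)] by blast
  obtain w' where w': "w' \<in> mspace W" "\<delta> y' w' < s / 4" using d(6)[OF y'(1)] by blast
  \<comment> \<open>Positivity of \<open>s\<close> is not assumed; it follows from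
    \<open>near\<close>, as couplings are nonnegative.\<close>
  have s0: "s > 0" using y(2) d(1)[OF y(1) w] by linarith
  have "mdist W w w' \<le> \<delta> y w + (s + \<delta> y' w')"
    using d(5)[OF y(1) w w'(1)] d(2)[OF y(1) y'(1) w'(1)] y'(2) by linarith
  then have "mdist W w w' < r" using y(2) w'(2) s s0 by linarith
  then have "w' = w" using sep w'(1) by (force simp: separated_point_def)
  then show False
    using d(3)[OF y(1) y'(1) w] y(2) y'(2) w'(2) s0 by simp
qed

text \<open>Asking for one representative with a separated point avoids having to prove that
  \<open>separated_point\<close> is invariant under isometry.\<close>

definition gh_separated :: "real \<Rightarrow> gh_space set" where
  "gh_separated r = {abs_gh_space X |X. nonempty_compact X \<and> (\<exists>x. separated_point X r x)}"

lemma gh_space_cases: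
  obtains X where "nonempty_compact X" "p = abs_gh_space X"
  by (induction p rule: gh_space.abs_induct) blast

lemma dist_abs_gh_space:
  assumes "nonempty_compact X" "nonempty_compact Y"
  shows "dist (abs_gh_space X) (abs_gh_space Y) = gh_distance X Y"
  using assms by (intro dist_gh_space.abs_eq) (simp_all add: eq_onp_def isometric_refl)

lemma gh_perfect_abs_gh_space:
  "nonempty_compact X \<Longrightarrow> gh_perfect (abs_gh_space X) \<longleftrightarrow> perfect_metric X"
  by (intro gh_perfect.abs_eq) (simp add: isometric_refl)

text \<open>Every ball contains the class of a doubled space, and the ball of radius
  \<open>s / 4\<close> around that class misses \<open>gh_separated r\<close>. Hence no ball lies in
  the closure.\<close>

lemma rare_gh_separated:
  assumes r: "r > 0" shows "rare (gh_separated r)"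
  unfolding rare_def
proof (rule ccontr)
  assume "interior (closure (gh_separated r)) \<noteq> {}"
  then obtain p e where e: "e > 0" "ball p e \<subseteq> closure (gh_separated r)"
    by (auto simp: mem_interior)
  obtain X where X: "nonempty_compact X" "p = abs_gh_space X" by (rule gh_space_cases)
  \<comment> \<open>The bound \<open>e / 2\<close> keeps the doubled space strictly inside the open
    ball, since doubling only gives distance at most \<open>s\<close>; the bound
    \<open>r / 2\<close> gives \<open>2 * s \<le> r\<close>.\<close>
  define s where "s = min (e / 2) (r / 2)"
  have s: "s > 0" "s < e" "2 * s \<le> r" using e r by (auto simp: s_def min_def)
  obtain Y where Y: "nonempty_compact Y" "gh_distance X Y \<le> s"
    and partner: "\<And>y. y \<in> mspace Y \<Longrightarrow> \<exists>y'\<in>mspace Y. mdist Y y y' = s"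
    using nonempty_compact_doubling[OF X(1) s(1)] by metis
  have "dist p (abs_gh_space Y) < e"
    using dist_abs_gh_space[OF X(1) Y(1)] Y(2) X(2) s(2) by simp
  then have "abs_gh_space Y \<in> closure (gh_separated r)" using e(2) by auto
  then obtain q where q: "q \<in> gh_separated r" "dist q (abs_gh_space Y) < s / 4"
    unfolding closure_approachable using s(1) by (metis divide_pos_pos zero_less_numeral)
  obtain W w where W: "nonempty_compact W" "q = abs_gh_space W" "separated_point W r w"
    using q(1) by (auto simp: gh_separated_def)
  have "gh_distance Y W < s / 4"
    using q(2) dist_abs_gh_space[OF Y(1) W(1)] W(2) by (simp add: dist_commute)
  then show False
    using no_separated_point_near[OF Y(1) W(1) _ s(3) partner] W(3) by blast
qed

lemma Compl_gh_perfect: "- {p. gh_perfect p} = (\<Union>n. gh_separated (1 / real (Suc n)))"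
proof (rule set_eqI)
  fix p
  obtain X where X: "nonempty_compact X" "p = abs_gh_space X" by (rule gh_space_cases)
  have "p \<in> - {p. gh_perfect p} \<longleftrightarrow> \<not> gh_perfect p" by simp
  also have "\<dots> \<longleftrightarrow> p \<in> (\<Union>n. gh_separated (1 / real (Suc n)))"
  proof
    assume "\<not> gh_perfect p"
    then obtain n x where "separated_point X (1 / real (Suc n)) x"
      using X(2) gh_perfect_abs_gh_space[OF X(1)] not_perfect_metric_iff[of X] by auto
    then show "p \<in> (\<Union>n. gh_separated (1 / real (Suc n)))"
      using X unfolding gh_separated_def by blast
  next
    assume "p \<in> (\<Union>n. gh_separated (1 / real (Suc n)))"
    then obtain n W w where W: "nonempty_compact W" "p = abs_gh_space W"
      "separated_point W (1 / real (Suc n)) w"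
      unfolding gh_separated_def by blast
    then show "\<not> gh_perfect p"
      using W(2,3) gh_perfect_abs_gh_space[OF W(1)] not_perfect_metric_iff[of W] by auto
  qed
  finally show "p \<in> - {p. gh_perfect p} \<longleftrightarrow> p \<in> (\<Union>n. gh_separated (1 / real (Suc n)))" .
qed

theorem theorem4:
  shows "residual {X :: gh_space. gh_perfect X}"
  unfolding residual_def meager_def Compl_gh_perfect
  by (intro exI[of _ "range (\<lambda>n. gh_separated (1 / real (Suc n)))"])
     (auto intro!: rare_gh_separated)

end
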